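(* Let $\mathbb F$ be a field, $A$ a finite-dimensional $\mathbb F$-algebra of dimension $n$, and $(\sigma,\delta)$ a left skew derivation of $A$ such that $\sigma$ is an $\mathbb F$-algebra automorphism and $\delta$ is $\mathbb F$-linear, with both $\delta$ and $\delta'=-\delta\sigma^{-1}$ nilpotent. Identify $\mathbb F^n$ with the regular right $A$-module $A$ through an $\mathbb F$-linear isomorphism $A\cong\mathbb F^n$. Then the map $\mathcal D\mapsto\mathcal D\cap A[X;\sigma,\delta]$ is a bijection between the set of all $(\sigma,\delta,A)$-cyclic convolutional codes in $A(\!(X;\sigma,\delta)\!)$ and the set of all right ideal codes.
   Context: Rings are associative and unital. A left skew derivation of $A$ is a pair $(\sigma,\delta)$ where $\sigma$ is a ring endomorphism of $A$ and $\delta:A\to A$ is additive with $\delta(ab)=\sigma(a)\delta(b)+\delta(a)b$. $A[X;\sigma,\delta]$ is the skew polynomial ring: free left $A$-module with basis $\{X^i:i\in\mathbb N\}$ and product determined by $X^iX^j=X^{i+j}$, $Xa=\sigma(a)X+\delta(a)$. $A[\![X]\!]$ and $A(\!(X)\!)$ denote the power series $\sum_{i\ge0}s_iX^i$ and Laurent series $\sum_{i\ge i_0}s_iX^i$ ($i_0\in\mathbb Z$) with coefficients in $A$. For an additive map $L:A\to A$ and $s=\sum_is_iX^i$, $L(s)=\sum_iL(s_i)X^i$. $[f]_n$ or $(f)_n$ is the coefficient of $X^n$ in $f$. Ring $A(\!(X;\sigma,\delta)\!)$: put $\sigma'=\sigma^{-1}$ and let $m\ge1$ with $\delta^m=\delta'^m=0$.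 For $a\in A$, $n\in\mathbb N$ let $O_n(a)$ be a natural number such that $(X^ja)_i=0$ in $A[X;\sigma,\delta]$ whenever $i\le n$, $j\ge O_n(a)$ (it exists). There is a unique ring structure on the additive group $A(\!(X)\!)$, denoted $A(\!(X;\sigma,\delta)\!)$, containing $A[X;\sigma,\delta]$ as a subring and such that, for $s,t\in A[\![X]\!]$, $\ell\in\mathbb Z$ and $q_n\ge\max_{0\le i\le n}O_n(t_i)$: $sX^\ell=\sum_{i\ge0}s_iX^{i+\ell}$; $st=\sum_{n\ge0}\left[\left(\sum_{i=0}^{q_n}s_iX^i\right)\left(\sum_{i=0}^nt_iX^i\right)\right]_nX^n$; $X^{-1}s=\sum_{k=0}^m\sigma'\delta'^k(s)X^{-1-k}$. The field $\mathbb F(\!(X)\!)$ is a subring of $A(\!(X;\sigma,\delta)\!)$, and $A(\!(X;\sigma,\delta)\!)$ is regarded as a right $\mathbb F(\!(X)\!)$-vector space and right $A$-module by right multiplication; likewise $A[X;\sigma,\delta]$ is a right $\mathbb F[X]$-module by right multiplication. A convolutional code in $A(\!(X;\sigma,\delta)\!)$ is an $\mathbb F(\!(X)\!)$-vector subspace having a basis consisting of elements of $A[X;\sigma,\delta]$ (this is the usual notion of convolutional code in $\mathbb F^n(\!(X)\!)$ under the identification $A\cong\mathbb F^n$). It is $(\sigma,\delta,A)$-cyclic if it is a right $A$-submodule of $A(\!(X;\sigma,\delta)\!)$. A right ideal code is a right ideal of $A[X;\sigma,\delta]$ that is a direct summand of $A[X;\sigma,\delta]$ as an $\mathbb F[X]$-module.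 *)

theory Defs
  imports
    "HOL-Analysis.Cartesian_Space"
    "HOL-Computational_Algebra.Formal_Laurent_Series"
    "HOL-Computational_Algebra.Polynomial_FPS"
begin

section \<open>Algebras and skew derivations\<close>

locale unital_algebra = vector_space smul
  for smul :: "'f::field \<Rightarrow> 'a::ring_1 \<Rightarrow> 'a" +
  assumes scale_mult_left: "smul c a * b = smul c (a * b)"
    and scale_mult_right: "a * smul c b = smul c (a * b)"

definition ring_endomorphism :: "('a::ring_1 \<Rightarrow> 'a) \<Rightarrow> bool"
  where "ring_endomorphism \<sigma> \<longleftrightarrow>
    (\<forall>a b. \<sigma> (a + b) = \<sigma> a + \<sigma> b) \<and> (\<forall>a b. \<sigma> (a * b) = \<sigma> a * \<sigma> b) \<and> \<sigma> 1 = 1"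

definition left_skew_derivation :: "('a::ring_1 \<Rightarrow> 'a) \<Rightarrow> ('a \<Rightarrow> 'a) \<Rightarrow> bool"
  where "left_skew_derivation \<sigma> \<delta> \<longleftrightarrow> ring_endomorphism \<sigma> \<and>
    (\<forall>a b. \<delta> (a + b) = \<delta> a + \<delta> b) \<and> (\<forall>a b. \<delta> (a * b) = \<sigma> a * \<delta> b + \<delta> a * b)"

definition nilpotent_map :: "('a::zero \<Rightarrow> 'a) \<Rightarrow> bool"
  where "nilpotent_map L \<longleftrightarrow> (\<exists>m. L ^^ m = (\<lambda>_. 0))"

definition dual_derivation :: "('a::ring_1 \<Rightarrow> 'a) \<Rightarrow> ('a \<Rightarrow> 'a) \<Rightarrow> 'a \<Rightarrow> 'a"
  where "dual_derivation \<sigma> \<delta> a = - \<delta> (inv \<sigma> a)"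


section \<open>The skew polynomial ring\<close>

text \<open>
  The additive group of \<open>A[X;\<sigma>,\<delta>]\<close> is \<^typ>\<open>'a poly\<close>, coefficients being written on
  the left of the powers of \<open>X\<close>. Left multiplication by \<open>X\<close> is forced by
  \<open>X (\<Sum>i. q\<^sub>i X\<^sup>i) = (\<Sum>i. (\<sigma> q\<^sub>i X + \<delta> q\<^sub>i) X\<^sup>i)\<close>.
\<close>

definition skew_X_times :: "('a::ring_1 \<Rightarrow> 'a) \<Rightarrow> ('a \<Rightarrow> 'a) \<Rightarrow> 'a poly \<Rightarrow> 'a poly"
  where "skew_X_times \<sigma> \<delta> q = pCons 0 (map_poly \<sigma> q) + map_poly \<delta> q"

definition skew_poly_mult ::
    "('a::ring_1 \<Rightarrow> 'a) \<Rightarrow> ('a \<Rightarrow> 'a) \<Rightarrow> 'a poly \<Rightarrow> 'a poly \<Rightarrow> 'a poly"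
  where "skew_poly_mult \<sigma> \<delta> p q =
    (\<Sum>i\<le>degree p. map_poly ((*) (coeff p i)) ((skew_X_times \<sigma> \<delta> ^^ i) q))"


section \<open>The skew Laurent series ring\<close>

definition fls_map :: "('a::zero \<Rightarrow> 'b::zero) \<Rightarrow> 'a fls \<Rightarrow> 'b fls"
  where "fls_map L s = Abs_fls (\<lambda>i. L (fls_nth s i))"

definition poly_to_fls :: "'a::zero poly \<Rightarrow> 'a fls"
  where "poly_to_fls p = fps_to_fls (fps_of_poly p)"

definition fps_truncate :: "nat \<Rightarrow> 'a::comm_monoid_add fps \<Rightarrow> 'a poly"
  where "fps_truncate n s = (\<Sum>i\<le>n. monom (fps_nth s i) i)"

text \<open>\<open>N\<close> is an admissible value of \<open>O\<^sub>n(a)\<close>.\<close>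

definition skew_bound :: "('a::ring_1 \<Rightarrow> 'a) \<Rightarrow> ('a \<Rightarrow> 'a) \<Rightarrow> nat \<Rightarrow> 'a \<Rightarrow> nat \<Rightarrow> bool"
  where "skew_bound \<sigma> \<delta> n a N \<longleftrightarrow>
    (\<forall>i j. i \<le> n \<longrightarrow> N \<le> j \<longrightarrow> coeff (skew_poly_mult \<sigma> \<delta> (monom 1 j) [:a:]) i = 0)"

text \<open>
  The type \<^typ>\<open>'a fls\<close> serves only as the additive group \<open>A((X))\<close>; its library product, for
  which \<open>X\<close> is central, is not used. Note that \<open>fls_X_intpow l\<close> is the \<open>l\<close>-th power of \<open>X\<close> and
  that \<open>fls_shift (- l) s\<close> is \<open>s X\<^sup>l\<close>, i.e. \<open>\<Sum>i. s\<^sub>i X\<^bsup>i + l\<^esup>\<close>.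
\<close>

definition is_skew_laurent_mult ::
    "('a::ring_1 \<Rightarrow> 'a) \<Rightarrow> ('a \<Rightarrow> 'a) \<Rightarrow> ('a fls \<Rightarrow> 'a fls \<Rightarrow> 'a fls) \<Rightarrow> bool"
  where "is_skew_laurent_mult \<sigma> \<delta> mul \<longleftrightarrow>
    class.ring_1 (1 :: 'a fls) mul (+) (0 :: 'a fls) (-) uminus \<and>
    (\<forall>p q. mul (poly_to_fls p) (poly_to_fls q) = poly_to_fls (skew_poly_mult \<sigma> \<delta> p q)) \<and>
    (\<forall>s l. mul (fps_to_fls s) (fls_X_intpow l) = fls_shift (- l) (fps_to_fls s)) \<and>
    (\<forall>s t q. (\<forall>n. \<forall>i\<le>n. skew_bound \<sigma> \<delta> n (fps_nth t i) (q n)) \<longrightarrow>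
      mul (fps_to_fls s) (fps_to_fls t) =
        fps_to_fls (Abs_fps (\<lambda>n.
          coeff (skew_poly_mult \<sigma> \<delta> (fps_truncate (q n) s) (fps_truncate n t)) n))) \<and>
    (\<forall>s m. 1 \<le> m \<longrightarrow> \<delta> ^^ m = (\<lambda>_. 0) \<longrightarrow> dual_derivation \<sigma> \<delta> ^^ m = (\<lambda>_. 0) \<longrightarrow>
      mul (fls_X_intpow (- 1)) (fps_to_fls s) =
        (\<Sum>k\<le>m. fls_shift (1 + int k)
          (fls_map (inv \<sigma> \<circ> dual_derivation \<sigma> \<delta> ^^ k) (fps_to_fls s))))"

definition skew_laurent_mult ::
    "('a::ring_1 \<Rightarrow> 'a) \<Rightarrow> ('a \<Rightarrow> 'a) \<Rightarrow> 'a fls \<Rightarrow> 'a fls \<Rightarrow> 'a fls"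
  where "skew_laurent_mult \<sigma> \<delta> = (THE mul. is_skew_laurent_mult \<sigma> \<delta> mul)"

section \<open>Convolutional codes and right ideal codes\<close>

text \<open>The right actions of \<open>F((X))\<close> and \<open>F[X]\<close>, through the embedding \<open>c \<mapsto> smul c 1\<close> of
  \<open>F\<close> into \<open>A\<close>. Both being commutative, these right actions are modules in the sense of the
  library, which writes scalars on the left.\<close>

definition laurent_scale :: "('f::field \<Rightarrow> 'a::ring_1 \<Rightarrow> 'a) \<Rightarrow> ('a \<Rightarrow> 'a) \<Rightarrow> ('a \<Rightarrow> 'a) \<Rightarrow>
    'f fls \<Rightarrow> 'a fls \<Rightarrow> 'a fls"
  where "laurent_scale smul \<sigma> \<delta> f s = skew_laurent_mult \<sigma> \<delta> s (fls_map (\<lambda>c. smul c 1) f)"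

definition poly_scale :: "('f::field \<Rightarrow> 'a::ring_1 \<Rightarrow> 'a) \<Rightarrow> ('a \<Rightarrow> 'a) \<Rightarrow> ('a \<Rightarrow> 'a) \<Rightarrow>
    'f poly \<Rightarrow> 'a poly \<Rightarrow> 'a poly"
  where "poly_scale smul \<sigma> \<delta> f p = skew_poly_mult \<sigma> \<delta> p (map_poly (\<lambda>c. smul c 1) f)"

definition convolutional_code :: "('f::field \<Rightarrow> 'a::ring_1 \<Rightarrow> 'a) \<Rightarrow> ('a \<Rightarrow> 'a) \<Rightarrow> ('a \<Rightarrow> 'a) \<Rightarrow>
    'a fls set \<Rightarrow> bool"
  where "convolutional_code smul \<sigma> \<delta> D \<longleftrightarrow>
    module.subspace (laurent_scale smul \<sigma> \<delta>) D \<and>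
    (\<exists>B \<subseteq> range poly_to_fls. \<not> module.dependent (laurent_scale smul \<sigma> \<delta>) B \<and>
       module.span (laurent_scale smul \<sigma> \<delta>) B = D)"

definition cyclic_convolutional_code :: "('f::field \<Rightarrow> 'a::ring_1 \<Rightarrow> 'a) \<Rightarrow> ('a \<Rightarrow> 'a) \<Rightarrow>
    ('a \<Rightarrow> 'a) \<Rightarrow> 'a fls set \<Rightarrow> bool"
  where "cyclic_convolutional_code smul \<sigma> \<delta> D \<longleftrightarrow> convolutional_code smul \<sigma> \<delta> D \<and>
    0 \<in> D \<and> (\<forall>s\<in>D. \<forall>t\<in>D. s + t \<in> D) \<and>
    (\<forall>s\<in>D. \<forall>a. skew_laurent_mult \<sigma> \<delta> s (fls_const a) \<in> D)"

definition skew_right_ideal :: "('a::ring_1 \<Rightarrow> 'a) \<Rightarrow> ('a \<Rightarrow> 'a) \<Rightarrow> 'a poly set \<Rightarrow> bool"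
  where "skew_right_ideal \<sigma> \<delta> I \<longleftrightarrow> 0 \<in> I \<and> (\<forall>p\<in>I. \<forall>q\<in>I. p + q \<in> I) \<and>
    (\<forall>p\<in>I. \<forall>q. skew_poly_mult \<sigma> \<delta> p q \<in> I)"

definition right_ideal_code :: "('f::field \<Rightarrow> 'a::ring_1 \<Rightarrow> 'a) \<Rightarrow> ('a \<Rightarrow> 'a) \<Rightarrow> ('a \<Rightarrow> 'a) \<Rightarrow>
    'a poly set \<Rightarrow> bool"
  where "right_ideal_code smul \<sigma> \<delta> I \<longleftrightarrow> skew_right_ideal \<sigma> \<delta> I \<and>
    module.subspace (poly_scale smul \<sigma> \<delta>) I \<and>
    (\<exists>J. module.subspace (poly_scale smul \<sigma> \<delta>) J \<and> I \<inter> J = {0} \<and>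
       (\<forall>p. \<exists>u\<in>I. \<exists>v\<in>J. p = u + v))"


section \<open>Existence and uniqueness of the skew Laurent series ring\<close>

text \<open>
  The product below is \<open>s t = (\<Sum>i. s\<^sub>i P\<^sub>i(t))\<close>, where \<open>P\<^sub>i\<close> is the \<open>i\<close>-th power (\<open>i \<in> \<int>\<close>) of the
  bijection \<open>T(t) = \<sigma>(t) X + \<delta>(t)\<close>. Associativity reduces to \<open>T(t u) = T(t) u\<close>.
\<close>

lemma nth_fls_map: "L 0 = 0 \<Longrightarrow> fls_nth (fls_map L s) n = L (fls_nth s n)"
  unfolding fls_map_def
  by (rule nth_Abs_fls_lower_bound[of "fls_subdegree s"]) auto

lemma nth_poly_to_fls: "fls_nth (poly_to_fls p) n = (if n < 0 then 0 else coeff p (nat n))"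
  by (simp add: poly_to_fls_def)

lemma coeff_fps_truncate: "coeff (fps_truncate n s) i = (if i \<le> n then fps_nth s i else 0)"
  by (simp add: fps_truncate_def coeff_sum)

locale nilpotent_skew_derivation =
  fixes \<sigma> \<delta> :: "'a::ring_1 \<Rightarrow> 'a"
  assumes der: "left_skew_derivation \<sigma> \<delta>" and bij: "bij \<sigma>"
    and nil: "nilpotent_map \<delta>" and nil': "nilpotent_map (dual_derivation \<sigma> \<delta>)"
begin

abbreviation "\<sigma>' \<equiv> inv \<sigma>"
abbreviation "\<delta>' \<equiv> dual_derivation \<sigma> \<delta>"

lemma \<sigma>_add: "\<sigma> (a + b) = \<sigma> a + \<sigma> b" and \<sigma>_mult: "\<sigma> (a * b) = \<sigma> a * \<sigma> b" and \<sigma>_1 [simp]: "\<sigma> 1 = 1"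
  and \<delta>_add: "\<delta> (a + b) = \<delta> a + \<delta> b" and \<delta>_mult: "\<delta> (a * b) = \<sigma> a * \<delta> b + \<delta> a * b"
  using der by (auto simp: left_skew_derivation_def ring_endomorphism_def)

lemma \<sigma>_\<sigma>' [simp]: "\<sigma> (\<sigma>' a) = a" and \<sigma>'_\<sigma> [simp]: "\<sigma>' (\<sigma> a) = a"
  using bij by (simp_all add: bij_is_surj surj_f_inv_f bij_is_inj inv_f_f)

sublocale s: additive \<sigma> by unfold_locales (rule \<sigma>_add)
sublocale d: additive \<delta> by unfold_locales (rule \<delta>_add)
sublocale s': additive \<sigma>'
  by unfold_locales (metis \<sigma>_add \<sigma>_\<sigma>' \<sigma>'_\<sigma>)
sublocale d': additive \<delta>'
  by unfold_locales (simp add: dual_derivation_def s'.add d.add)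

lemma add_d_pow: "additive (\<delta> ^^ k)" and add_d'_pow: "additive (\<delta>' ^^ k)"
  by (induction k) (auto simp: additive_def d.add d'.add)

lemma \<delta>_1 [simp]: "\<delta> 1 = 0"
  using \<delta>_mult[of 1 1] by simp

lemmas zeros [simp] = s.zero d.zero s'.zero d'.zero

lemma d'_pow_0 [simp]: "(\<delta>' ^^ k) 0 = 0" by (induction k) auto
lemma d_pow_0 [simp]: "(\<delta> ^^ k) 0 = 0" by (induction k) auto

lemma ex_m: "\<exists>m. 1 \<le> m \<and> \<delta> ^^ m = (\<lambda>_. 0) \<and> \<delta>' ^^ m = (\<lambda>_. 0)"
proof -
  obtain k l where k: "\<delta> ^^ k = (\<lambda>_. 0)" and l: "\<delta>' ^^ l = (\<lambda>_. 0)"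
    using nil nil' by (auto simp: nilpotent_map_def)
  have 1: "\<delta> ^^ (k + l + 1) = (\<lambda>_. 0)"
    using k by (metis (no_types) add.assoc add.commute funpow_add comp_def d_pow_0)
  have 2: "\<delta>' ^^ (k + l + 1) = (\<lambda>_. 0)"
    using l by (metis (no_types) add.assoc add.commute funpow_add comp_def d'_pow_0)
  show ?thesis using 1 2 by (intro exI[of _ "k + l + 1"]) simp
qed

definition T :: "'a fls \<Rightarrow> 'a fls" where
  "T s = fls_shift (- 1) (fls_map \<sigma> s) + fls_map \<delta> s"

lemma T_nth: "fls_nth (T s) n = \<sigma> (fls_nth s (n - 1)) + \<delta> (fls_nth s n)"
  by (simp add: T_def nth_fls_map)

definition U :: "nat \<Rightarrow> 'a fls \<Rightarrow> 'a fls" where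
  "U m s = (\<Sum>k\<le>m. fls_shift (1 + int k) (fls_map (\<sigma>' \<circ> \<delta>' ^^ k) s))"

lemma U_nth: "fls_nth (U m s) n = (\<Sum>k\<le>m. \<sigma>' ((\<delta>' ^^ k) (fls_nth s (n + 1 + int k))))"
  by (simp add: U_def fls_nth_sum nth_fls_map algebra_simps)

lemma \<delta>\<sigma>': "\<delta> (\<sigma>' a) = - \<delta>' a" by (simp add: dual_derivation_def)
lemma \<delta>'\<sigma>: "\<delta>' (\<sigma> a) = - \<delta> a" by (simp add: dual_derivation_def)

lemma T_U:
  assumes m: "\<delta>' ^^ m = (\<lambda>_. 0)" shows "T (U m s) = s"
proof (rule fls_eqI)
  fix n
  let ?f = "\<lambda>k. (\<delta>' ^^ k) (fls_nth s (n + int k))"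
  have "fls_nth (T (U m s)) n = (\<Sum>k\<le>m. ?f k) + (\<Sum>k\<le>m. - ?f (Suc k))"
    by (simp add: T_nth U_nth s.sum d.sum \<delta>\<sigma>' algebra_simps)
  also have "\<dots> = (\<Sum>k\<le>m. ?f k - ?f (Suc k))" by (simp add: sum.distrib[symmetric])
  also have "\<dots> = ?f 0 - ?f (Suc m)" by (rule sum_telescope)
  also have "?f (Suc m) = 0" using m by simp
  finally show "fls_nth (T (U m s)) n = fls_nth s n" by simp
qed

lemma U_T:
  assumes m: "\<delta>' ^^ m = (\<lambda>_. 0)" shows "U m (T s) = s"
proof (rule fls_eqI)
  fix n
  let ?g = "\<lambda>k. (\<delta>' ^^ k) (\<sigma> (fls_nth s (n + int k)))"
  have "fls_nth (U m (T s)) n = (\<Sum>k\<le>m. \<sigma>' (?g k - ?g (Suc k)))"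
    unfolding U_nth T_nth
  proof (intro sum.cong refl arg_cong[of _ _ "\<sigma>'"])
    fix k
    interpret p: additive "\<delta>' ^^ k" by (rule add_d'_pow)
    show "(\<delta>' ^^ k) (\<sigma> (fls_nth s (n + 1 + int k - 1)) + \<delta> (fls_nth s (n + 1 + int k))) = ?g k - ?g (Suc k)"
      unfolding funpow_Suc_right comp_def \<delta>'\<sigma> p.add p.minus by (simp add: algebra_simps)
  qed
  also have "\<dots> = \<sigma>' (?g 0 - ?g (Suc m))"
    unfolding s'.sum[symmetric] by (subst sum_telescope) simp
  also have "?g (Suc m) = 0" using m by simp
  finally show "fls_nth (U m (T s)) n = fls_nth s n" by simp
qed

lemma bij_T: "bij T"
  using ex_m T_U U_T by (metis bijI')

definition P :: "int \<Rightarrow> 'a fls \<Rightarrow> 'a fls" where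
  "P i = (if 0 \<le> i then T ^^ nat i else inv T ^^ nat (- i))"

lemma T_inv_T [simp]: "T (inv T s) = s" and inv_T_T [simp]: "inv T (T s) = s"
  using bij_T by (simp_all add: bij_is_surj surj_f_inv_f bij_is_inj inv_f_f)

lemma P_0 [simp]: "P 0 s = s" by (simp add: P_def)

lemma T_P: "T (P i s) = P (i + 1) s"
proof (cases "0 \<le> i")
  case True
  then show ?thesis by (simp add: P_def nat_add_distrib)
next
  case False
  show ?thesis
  proof (cases "i = -1")
    case True then show ?thesis by (simp add: P_def)
  next
    case i: False
    have "nat (- i) = Suc (nat (- (i + 1)))" using False i by simp
    then show ?thesis using False i by (simp add: P_def)
  qed
qed

lemma P_minus: "P (i - 1) s = inv T (P i s)"
  using T_P[of "i - 1" s] inv_T_T[of "P (i - 1) s"] by simp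

lemma P_neg1: "\<delta>' ^^ m = (\<lambda>_. 0) \<Longrightarrow> P (- 1) s = U m s"
  using P_minus[of 0 s] T_U[of m s] inv_T_T[of "U m s"] by simp

lemma T_add: "T (s + t) = T s + T t"
  by (rule fls_eqI) (simp add: T_nth s.add d.add algebra_simps)

lemma inv_T_add: "inv T (s + t) = inv T s + inv T t"
  by (metis T_add T_inv_T inv_T_T)

lemma int_updown [case_names 0 up down]:
  assumes "Q (0::int)" "\<And>i. Q i \<Longrightarrow> Q (i + 1)" "\<And>i. Q i \<Longrightarrow> Q (i - 1)"
  shows "Q i"
  by (induction i rule: int_induct[of _ 0]) (use assms in auto)

lemma P_add: "P i (s + t) = P i s + P i t"
proof (induction i rule: int_updown)
  case 0 show ?case by simp
next
  case (up i) then show ?case by (metis T_P T_add)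
next
  case (down i) then show ?case by (metis P_minus inv_T_add)
qed

lemma P_zero [simp]: "P i 0 = 0" using P_add[of i 0 0] by simp

lemma T_X: "T (fls_X_intpow l) = fls_X_intpow (l + 1)"
  by (rule fls_eqI) (auto simp: T_nth)

lemma P_X: "P i (fls_X_intpow l) = fls_X_intpow (l + i)"
proof (induction i rule: int_updown)
  case 0 show ?case by simp
next
  case (up i) then show ?case by (metis T_P T_X add.assoc)
next
  case (down i)
  have "P (i - 1) (fls_X_intpow l) = inv T (fls_X_intpow (l + i))" by (simp only: P_minus down)
  also have "\<dots> = inv T (T (fls_X_intpow (l + (i - 1))))" unfolding T_X by (simp add: algebra_simps)
  finally show ?case by simp
qed

lemma low:
  obtains d where "\<And>n. n < d \<Longrightarrow> fls_nth s n = 0"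
  using fls_eq0_below_subdegree by blast

lemma P_low_nonneg:
  assumes "\<And>n. n < d \<Longrightarrow> fls_nth s n = 0" "0 \<le> i" "n < d"
  shows "fls_nth (P i s) n = 0"
proof -
  have "fls_nth ((T ^^ j) s) n = 0" if "n < d" for j n
    using that by (induction j arbitrary: n) (auto simp: T_nth assms(1))
  then show ?thesis using assms by (simp add: P_def)
qed

lemma P_low: \<comment> \<open>common order bound for all \<open>P i s\<close> with \<open>i \<ge> e\<close>\<close>
  obtains d where "\<And>i n. e \<le> i \<Longrightarrow> n < d \<Longrightarrow> fls_nth (P i s) n = 0"
proof -
  have "\<exists>d. \<forall>i n. - int k \<le> i \<longrightarrow> n < d \<longrightarrow> fls_nth (P i s) n = 0" for k
  proof (induction k)
    case 0 then show ?case using P_low_nonneg low by (metis neg_0_le_iff_le of_nat_0 minus_zero)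
  next
    case (Suc k)
    then obtain d where d: "\<And>i n. - int k \<le> i \<Longrightarrow> n < d \<Longrightarrow> fls_nth (P i s) n = 0" by blast
    obtain d' where d': "\<And>n. n < d' \<Longrightarrow> fls_nth (P (- int (Suc k)) s) n = 0" using low by blast
    have "fls_nth (P i s) n = 0" if "- int (Suc k) \<le> i" "n < min d d'" for i n
      using that d[of i n] d'[of n] by (cases "i = - int (Suc k)") auto
    then show ?case by blast
  qed
  from this[of "nat (- e)"] obtain d where "\<And>i n. - int (nat (- e)) \<le> i \<Longrightarrow> n < d \<Longrightarrow> fls_nth (P i s) n = 0"
    by blast
  then show ?thesis using that[of d] by simp
qed

lemma T_pow_vanish:
  assumes "\<And>i. i \<ge> N \<Longrightarrow> fls_nth (P i s) (n - 1) = 0"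
  shows "fls_nth (P (N + int k) s) n = (\<delta> ^^ k) (fls_nth (P N s) n)"
proof (induction k)
  case (Suc k)
  have "fls_nth (P (N + int (Suc k)) s) n = fls_nth (T (P (N + int k) s)) n"
    by (simp add: T_P algebra_simps)
  then show ?case using assms Suc by (simp add: T_nth)
qed simp

lemma P_high: obtains N where "\<And>i j. i \<ge> N \<Longrightarrow> j \<le> n \<Longrightarrow> fls_nth (P i s) j = 0"
proof -
  obtain d where d: "\<And>i n. 0 \<le> i \<Longrightarrow> n < d \<Longrightarrow> fls_nth (P i s) n = 0" using P_low[of 0 s] by blast
  obtain m where m: "\<delta> ^^ m = (\<lambda>_. 0)" using ex_m by blast
  have "\<exists>N. \<forall>i j. i \<ge> N \<longrightarrow> j \<le> d - 1 + int k \<longrightarrow> fls_nth (P i s) j = 0" for k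
  proof (induction k)
    case 0 then show ?case using d by (intro exI[of _ 0]) auto
  next
    case (Suc k)
    then obtain N where N: "\<And>i j. i \<ge> N \<Longrightarrow> j \<le> d - 1 + int k \<Longrightarrow> fls_nth (P i s) j = 0" by blast
    have "fls_nth (P i s) j = 0" if "i \<ge> N + int m" "j \<le> d - 1 + int (Suc k)" for i j
    proof (cases "j = d + int k")
      case True
      let ?M = "i - int m"
      have "fls_nth (P (?M + int m) s) j = (\<delta> ^^ m) (fls_nth (P ?M s) j)"
        using N that True by (intro T_pow_vanish) auto
      then show ?thesis using m by simp
    next
      case False then show ?thesis using N that by auto
    qed
    then show ?case by blast
  qed
  from this[of "nat (n - d + 1)"] obtain N
    where N: "\<And>i j. i \<ge> N \<Longrightarrow> j \<le> d - 1 + int (nat (n - d + 1)) \<Longrightarrow> fls_nth (P i s) j = 0" by blast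
  show ?thesis by (rule that[of N], rule N) auto
qed

definition lmc :: "'a fls \<Rightarrow> 'a fls \<Rightarrow> int \<Rightarrow> 'a" where
  "lmc s t n = (\<Sum>i | fls_nth s i * fls_nth (P i t) n \<noteq> 0. fls_nth s i * fls_nth (P i t) n)"

definition lm :: "'a fls \<Rightarrow> 'a fls \<Rightarrow> 'a fls" where "lm s t = Abs_fls (lmc s t)"

lemma lm_nth: "fls_nth (lm s t) n = lmc s t n"
proof -
  obtain e where e: "\<And>i. i < e \<Longrightarrow> fls_nth s i = 0" using low by blast
  obtain d where d: "\<And>i n. e \<le> i \<Longrightarrow> n < d \<Longrightarrow> fls_nth (P i t) n = 0" using P_low[of e t] by blast
  have "lmc s t n = 0" if "n < d" for n
  proof -
    have "fls_nth s i * fls_nth (P i t) n = 0" for i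
      using e[of i] d[of i n] that by (cases "i < e") auto
    then show ?thesis by (simp add: lmc_def)
  qed
  then show ?thesis unfolding lm_def by (intro nth_Abs_fls_lower_bound[of d]) auto
qed

lemma lm_sum:
  assumes "finite S" "\<And>i. i \<notin> S \<Longrightarrow> fls_nth s i = 0 \<or> fls_nth (P i t) n = 0"
  shows "fls_nth (lm s t) n = (\<Sum>i\<in>S. fls_nth s i * fls_nth (P i t) n)"
  unfolding lm_nth lmc_def
  by (rule sum.mono_neutral_left) (use assms in force)+

lemma lm_sum_interval:
  assumes "\<And>i. i < e \<Longrightarrow> fls_nth s i = 0" "\<And>i. i \<ge> N \<Longrightarrow> fls_nth (P i t) n = 0"
  shows "fls_nth (lm s t) n = (\<Sum>i=e..<N. fls_nth s i * fls_nth (P i t) n)"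
  by (rule lm_sum) (use assms in force)+

lemma lm_add_left: "lm (s + s') t = lm s t + lm s' t"
proof (rule fls_eqI)
  fix n
  obtain e where e: "\<And>i. i < e \<Longrightarrow> fls_nth s i = 0" using low by blast
  obtain e' where e': "\<And>i. i < e' \<Longrightarrow> fls_nth s' i = 0" using low by blast
  obtain N where N: "\<And>i j. i \<ge> N \<Longrightarrow> j \<le> n \<Longrightarrow> fls_nth (P i t) j = 0" using P_high by blast
  let ?S = "{min e e'..<N}"
  have "fls_nth (lm u t) n = (\<Sum>i\<in>?S. fls_nth u i * fls_nth (P i t) n)" if "u \<in> {s, s', s + s'}" for u
    using that by (intro lm_sum_interval) (auto simp: e e' N)
  then show "fls_nth (lm (s + s') t) n = fls_nth (lm s t + lm s' t) n"
    by (simp add: sum.distrib[symmetric] algebra_simps)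
qed

lemma lm_add_right: "lm s (t + t') = lm s t + lm s t'"
proof (rule fls_eqI)
  fix n
  obtain e where e: "\<And>i. i < e \<Longrightarrow> fls_nth s i = 0" using low by blast
  obtain N where N: "\<And>i j. i \<ge> N \<Longrightarrow> j \<le> n \<Longrightarrow> fls_nth (P i t) j = 0" using P_high by blast
  obtain N' where N': "\<And>i j. i \<ge> N' \<Longrightarrow> j \<le> n \<Longrightarrow> fls_nth (P i t') j = 0" using P_high by blast
  let ?S = "{e..<max N N'}"
  have "fls_nth (lm s u) n = (\<Sum>i\<in>?S. fls_nth s i * fls_nth (P i u) n)" if "u \<in> {t, t', t + t'}" for u
    using that by (intro lm_sum_interval) (auto simp: e N N' P_add)
  then show "fls_nth (lm s (t + t')) n = fls_nth (lm s t + lm s t') n"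
    by (simp add: sum.distrib[symmetric] algebra_simps P_add)
qed

lemma lm_X_right: "lm s (fls_X_intpow l) = fls_shift (- l) s"
proof (rule fls_eqI)
  fix n
  have "fls_nth (lm s (fls_X_intpow l)) n = (\<Sum>i\<in>{n - l}. fls_nth s i * fls_nth (P i (fls_X_intpow l)) n)"
    by (rule lm_sum) (auto simp: P_X)
  then show "fls_nth (lm s (fls_X_intpow l)) n = fls_nth (fls_shift (- l) s) n" by (simp add: P_X)
qed

lemma lm_X_left: "lm (fls_X_intpow l) s = P l s"
proof (rule fls_eqI)
  fix n
  have "fls_nth (lm (fls_X_intpow l) s) n = (\<Sum>i\<in>{l}. fls_nth (fls_X_intpow l) i * fls_nth (P i s) n)"
    by (rule lm_sum) auto
  then show "fls_nth (lm (fls_X_intpow l) s) n = fls_nth (P l s) n" by simp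
qed

lemma T_lm: "T (lm t u) = lm (T t) u"
proof (rule fls_eqI)
  fix n
  obtain d where d: "\<And>j. j < d \<Longrightarrow> fls_nth t j = 0" using low by blast
  obtain N0 where "\<And>i j. i \<ge> N0 \<Longrightarrow> j \<le> n \<Longrightarrow> fls_nth (P i u) j = 0" using P_high by blast
  then obtain N where N: "\<And>i j. i \<ge> N \<Longrightarrow> j \<le> n \<Longrightarrow> fls_nth (P i u) j = 0" and dN: "d \<le> N"
    by (metis max.cobounded2 max.cobounded1 order_trans)
  let ?Q = "\<lambda>j. fls_nth (P j u) n"
  have *: "fls_nth (lm t u) k = (\<Sum>j=d..<N. fls_nth t j * fls_nth (P j u) k)" if "k \<le> n" for k
    using that by (intro lm_sum_interval) (auto simp: d N)
  have "fls_nth (T (lm t u)) n =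
      (\<Sum>j=d..<N. \<sigma> (fls_nth t j) * fls_nth (T (P j u)) n + \<delta> (fls_nth t j) * ?Q j)"
    by (simp add: T_nth * s.sum d.sum \<sigma>_mult \<delta>_mult sum.distrib algebra_simps)
  also have "\<dots> = (\<Sum>j=d..<N. \<sigma> (fls_nth t j) * ?Q (j + 1)) + (\<Sum>j=d..<N. \<delta> (fls_nth t j) * ?Q j)"
    by (simp add: T_P sum.distrib)
  also have "(\<Sum>j=d..<N. \<sigma> (fls_nth t j) * ?Q (j + 1)) = (\<Sum>j=d+1..<N+1. \<sigma> (fls_nth t (j - 1)) * ?Q j)"
    by (rule sum.reindex_bij_witness[of _ "\<lambda>j. j - 1" "\<lambda>j. j + 1"]) auto
  also have "\<dots> = (\<Sum>j=d..<N. \<sigma> (fls_nth t (j - 1)) * ?Q j)"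
    by (rule sum.mono_neutral_cong) (auto simp: N d)
  finally have "fls_nth (T (lm t u)) n = (\<Sum>j=d..<N. fls_nth (T t) j * ?Q j)"
    by (simp add: T_nth sum.distrib[symmetric] algebra_simps)
  also have "\<dots> = fls_nth (lm (T t) u) n"
    by (rule lm_sum_interval[symmetric]) (auto simp: N d T_nth)
  finally show "fls_nth (T (lm t u)) n = fls_nth (lm (T t) u) n" .
qed

lemma P_lm: "P i (lm t u) = lm (P i t) u"
proof (induction i rule: int_updown)
  case 0 show ?case by simp
next
  case (up i) then show ?case by (metis T_P T_lm)
next
  case (down i) then show ?case by (metis P_minus T_lm T_inv_T inv_T_T)
qed

lemma lm_assoc: "lm (lm s t) u = lm s (lm t u)"
proof (rule fls_eqI)
  fix n
  obtain e where e: "\<And>i. i < e \<Longrightarrow> fls_nth s i = 0" using low by blast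
  obtain d where d: "\<And>i n. e \<le> i \<Longrightarrow> n < d \<Longrightarrow> fls_nth (P i t) n = 0" using P_low[of e t] by blast
  obtain N where N: "\<And>i j. i \<ge> N \<Longrightarrow> j \<le> n \<Longrightarrow> fls_nth (P i u) j = 0" using P_high by blast
  obtain M where M: "\<And>i j. i \<ge> M \<Longrightarrow> j \<le> N \<Longrightarrow> fls_nth (P i t) j = 0" using P_high by blast
  obtain M' where M': "\<And>i j. i \<ge> M' \<Longrightarrow> j \<le> n \<Longrightarrow> fls_nth (P i (lm t u)) j = 0" using P_high by blast
  let ?M = "max M M'"
  let ?t = "\<lambda>i j. fls_nth (P i t) j" and ?u = "\<lambda>j. fls_nth (P j u) n"
  have st: "fls_nth (lm s t) j = (\<Sum>i=e..<?M. fls_nth s i * ?t i j)" if "j \<le> N" for j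
    using that by (intro lm_sum_interval) (auto simp: e M)
  have low_st: "fls_nth (lm s t) j = 0" if "j < d" for j
    using that e d by (subst lm_sum[of "{}"]) (auto simp: not_less[symmetric])
  have "fls_nth (lm (lm s t) u) n = (\<Sum>j=d..<N. fls_nth (lm s t) j * ?u j)"
    by (rule lm_sum_interval) (auto simp: low_st N)
  also have "\<dots> = (\<Sum>j=d..<N. \<Sum>i=e..<?M. fls_nth s i * (?t i j * ?u j))"
    by (simp add: st sum_distrib_right mult.assoc)
  also have "\<dots> = (\<Sum>i=e..<?M. fls_nth s i * (\<Sum>j=d..<N. ?t i j * ?u j))"
    by (subst sum.swap) (simp add: sum_distrib_left)
  also have "\<dots> = (\<Sum>i=e..<?M. fls_nth s i * fls_nth (P i (lm t u)) n)"
  proof (rule sum.cong)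
    fix i assume "i \<in> {e..<?M}"
    then have "fls_nth (lm (P i t) u) n = (\<Sum>j=d..<N. ?t i j * ?u j)"
      by (intro lm_sum_interval) (auto simp: d N)
    then show "fls_nth s i * (\<Sum>j=d..<N. ?t i j * ?u j) = fls_nth s i * fls_nth (P i (lm t u)) n"
      by (simp add: P_lm)
  qed simp
  also have "\<dots> = fls_nth (lm s (lm t u)) n"
    by (rule lm_sum_interval[symmetric]) (auto simp: e M')
  finally show "fls_nth (lm (lm s t) u) n = fls_nth (lm s (lm t u)) n" .
qed

lemma lm_ring: "class.ring_1 (1 :: 'a fls) lm (+) 0 (-) uminus"
proof unfold_locales
  show "lm 1 s = s" for s using lm_X_left[of 0 s] by simp
  show "lm s 1 = s" for s using lm_X_right[of s 0] by simp
qed (simp_all add: lm_assoc lm_add_left lm_add_right)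

lemma coeff_skew_X_times:
  "coeff (skew_X_times \<sigma> \<delta> q) n = (if n = 0 then 0 else \<sigma> (coeff q (n - 1))) + \<delta> (coeff q n)"
  by (cases n) (simp_all add: skew_X_times_def coeff_map_poly)

lemma T_poly: "T (poly_to_fls q) = poly_to_fls (skew_X_times \<sigma> \<delta> q)"
  by (rule fls_eqI) (auto simp: T_nth nth_poly_to_fls coeff_skew_X_times nat_diff_distrib)

lemma P_poly: "P (int i) (poly_to_fls q) = poly_to_fls ((skew_X_times \<sigma> \<delta> ^^ i) q)"
  by (simp add: P_def) (induction i, auto simp: T_poly)

lemma coeff_skew_poly_mult:
  "coeff (skew_poly_mult \<sigma> \<delta> p q) n =
    (\<Sum>i\<le>degree p. coeff p i * fls_nth (P (int i) (poly_to_fls q)) (int n))"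
  by (simp add: skew_poly_mult_def coeff_sum coeff_map_poly P_poly nth_poly_to_fls)

lemma coeff_skew_monom_mult:
  "coeff (skew_poly_mult \<sigma> \<delta> (monom 1 j) q) n = fls_nth (P (int j) (poly_to_fls q)) (int n)"
proof -
  have "coeff (skew_poly_mult \<sigma> \<delta> (monom 1 j) q) n =
      (\<Sum>i\<in>{j}. coeff (monom 1 j) i * fls_nth (P (int i) (poly_to_fls q)) (int n))"
    unfolding coeff_skew_poly_mult by (rule sum.mono_neutral_right) (auto simp: degree_monom_eq)
  then show ?thesis by simp
qed

lemma lm_nonneg:
  assumes "\<And>i. i < 0 \<Longrightarrow> fls_nth s i = 0" "\<And>i. int q < i \<Longrightarrow> fls_nth s i = 0 \<or> fls_nth (P i t) n = 0"
  shows "fls_nth (lm s t) n = (\<Sum>i\<le>q. fls_nth s (int i) * fls_nth (P (int i) t) n)"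
proof -
  have "fls_nth (lm s t) n = (\<Sum>i\<in>int ` {..q}. fls_nth s i * fls_nth (P i t) n)"
  proof (rule lm_sum)
    fix i assume "i \<notin> int ` {..q}"
    then have "i < 0 \<or> int q < i" by (metis atMost_iff image_eqI nonneg_int_cases not_le of_nat_le_iff)
    then show "fls_nth s i = 0 \<or> fls_nth (P i t) n = 0" using assms by auto
  qed simp
  then show ?thesis by (simp add: sum.reindex)
qed

lemma lm_poly: "lm (poly_to_fls p) (poly_to_fls q) = poly_to_fls (skew_poly_mult \<sigma> \<delta> p q)"
proof (rule fls_eqI)
  fix n
  have eq: "fls_nth (lm (poly_to_fls p) (poly_to_fls q)) n =
      (\<Sum>i\<le>degree p. fls_nth (poly_to_fls p) (int i) * fls_nth (P (int i) (poly_to_fls q)) n)"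
    by (rule lm_nonneg) (auto simp: nth_poly_to_fls coeff_eq_0)
  show "fls_nth (lm (poly_to_fls p) (poly_to_fls q)) n = fls_nth (poly_to_fls (skew_poly_mult \<sigma> \<delta> p q)) n"
  proof (cases "n < 0")
    case True
    then show ?thesis unfolding eq by (simp add: P_poly nth_poly_to_fls)
  next
    case False
    then obtain k where "n = int k" by (metis nonneg_int_cases not_le)
    then show ?thesis unfolding eq by (simp add: nth_poly_to_fls coeff_skew_poly_mult)
  qed
qed

lemma P_sum: "P i (sum f S) = (\<Sum>x\<in>S. P i (f x))"
  by (induction S rule: infinite_finite_induct) (auto simp: P_add)

lemma P_cong_le:
  assumes "\<And>k. k \<le> n \<Longrightarrow> fls_nth s k = fls_nth t k"
  shows "fls_nth (P (int i) s) n = fls_nth (P (int i) t) n"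
proof -
  have "k \<le> n \<Longrightarrow> fls_nth ((T ^^ i) s) k = fls_nth ((T ^^ i) t) k" for k
    by (induction i arbitrary: k) (auto simp: T_nth assms)
  then show ?thesis by (simp add: P_def)
qed

lemma P_shift: "P i (fls_shift l s) = fls_shift l (P i s)"
  using P_lm[of i s "fls_X_intpow (- l)"] unfolding lm_X_right by simp

lemma skew_bound_vanish:
  assumes "\<forall>j\<le>n. skew_bound \<sigma> \<delta> n (fps_nth t j) q" "q \<le> i"
  shows "fls_nth (P (int i) (fps_to_fls t)) (int n) = 0"
proof -
  have "fls_nth (P (int i) (fps_to_fls t)) (int n)
      = fls_nth (P (int i) (\<Sum>j\<le>n. fls_shift (- int j) (poly_to_fls [:fps_nth t j:]))) (int n)"
  proof (rule P_cong_le)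
    fix k assume k: "k \<le> int n"
    show "fls_nth (fps_to_fls t) k = fls_nth (\<Sum>j\<le>n. fls_shift (- int j) (poly_to_fls [:fps_nth t j:])) k"
    proof (cases "k < 0")
      case True then show ?thesis by (simp add: fls_nth_sum nth_poly_to_fls)
    next
      case False
      then obtain k' where k': "k = int k'" by (metis nonneg_int_cases not_le)
      have "(\<Sum>j\<le>n. fls_nth (fls_shift (- int j) (poly_to_fls [:fps_nth t j:])) k)
         = (\<Sum>j\<in>{k'}. fls_nth (fls_shift (- int j) (poly_to_fls [:fps_nth t j:])) k)"
        using k k' by (intro sum.mono_neutral_right) (auto simp: nth_poly_to_fls coeff_pCons split: nat.splits)
      then show ?thesis using k' by (simp add: fls_nth_sum nth_poly_to_fls)
    qed
  qed
  also have "\<dots> = (\<Sum>j\<le>n. fls_nth (P (int i) (poly_to_fls [:fps_nth t j:])) (int (n - j)))"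
    by (simp add: P_sum fls_nth_sum P_shift of_nat_diff)
  also have "\<dots> = 0"
  proof (intro sum.neutral ballI)
    fix j assume "j \<in> {..n}"
    then have "coeff (skew_poly_mult \<sigma> \<delta> (monom 1 i) [:fps_nth t j:]) (n - j) = 0"
      using assms unfolding skew_bound_def by simp
    then show "fls_nth (P (int i) (poly_to_fls [:fps_nth t j:])) (int (n - j)) = 0"
      by (simp only: coeff_skew_monom_mult)
  qed
  finally show ?thesis .
qed

lemma lm_power:
  assumes q: "\<forall>n. \<forall>i\<le>n. skew_bound \<sigma> \<delta> n (fps_nth t i) (q n)"
  shows "lm (fps_to_fls s) (fps_to_fls t) =
        fps_to_fls (Abs_fps (\<lambda>n.
          coeff (skew_poly_mult \<sigma> \<delta> (fps_truncate (q n) s) (fps_truncate n t)) n))"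
proof (rule fls_eqI)
  fix n
  show "fls_nth (lm (fps_to_fls s) (fps_to_fls t)) n = fls_nth (fps_to_fls (Abs_fps (\<lambda>n.
          coeff (skew_poly_mult \<sigma> \<delta> (fps_truncate (q n) s) (fps_truncate n t)) n))) n"
  proof (cases "n < 0")
    case True
    have "fls_nth (P i (fps_to_fls t)) n = 0" if "i \<ge> 0" for i
      using True that by (intro P_low_nonneg[of 0]) auto
    then have "fls_nth (lm (fps_to_fls s) (fps_to_fls t)) n = 0"
      by (subst lm_sum[of "{}"]) (auto simp: not_less)
    then show ?thesis using True by simp
  next
    case False
    then obtain k where k: "n = int k" by (metis nonneg_int_cases not_le)
    let ?p = "fps_truncate (q k) s" and ?r = "fps_truncate k t"
    have deg: "degree ?p \<le> q k" by (rule degree_le) (simp add: coeff_fps_truncate)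
    have "fls_nth (lm (fps_to_fls s) (fps_to_fls t)) n =
      (\<Sum>i\<le>q k. fls_nth (fps_to_fls s) (int i) * fls_nth (P (int i) (fps_to_fls t)) n)"
    proof (rule lm_nonneg)
      fix i assume "int (q k) < i"
      then obtain i' where "i = int i'" "q k \<le> i'" by (metis less_imp_le nonneg_int_cases of_nat_0_le_iff of_nat_le_iff order_trans)
      then show "fls_nth (fps_to_fls s) i = 0 \<or> fls_nth (P i (fps_to_fls t)) n = 0"
        using skew_bound_vanish[of k t "q k" i'] q k by simp
    qed simp
    also have "\<dots> = (\<Sum>i\<le>q k. coeff ?p i * fls_nth (P (int i) (poly_to_fls ?r)) n)"
    proof (rule sum.cong)
      fix i assume "i \<in> {..q k}"
      moreover have "fls_nth (P (int i) (fps_to_fls t)) n = fls_nth (P (int i) (poly_to_fls ?r)) n"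
        by (rule P_cong_le) (auto simp: k nth_poly_to_fls coeff_fps_truncate)
      ultimately show "fls_nth (fps_to_fls s) (int i) * fls_nth (P (int i) (fps_to_fls t)) n =
          coeff ?p i * fls_nth (P (int i) (poly_to_fls ?r)) n"
        by (simp add: coeff_fps_truncate)
    qed simp
    also have "\<dots> = (\<Sum>i\<le>degree ?p. coeff ?p i * fls_nth (P (int i) (poly_to_fls ?r)) n)"
      by (rule sum.mono_neutral_right) (use deg in \<open>auto simp: coeff_eq_0\<close>)
    finally show ?thesis by (simp add: k coeff_skew_poly_mult)
  qed
qed

lemma lm_is: "is_skew_laurent_mult \<sigma> \<delta> lm"
  unfolding is_skew_laurent_mult_def lm_X_left lm_X_right
  by (intro conjI allI impI lm_ring lm_poly lm_power refl) (simp_all add: P_neg1 U_def)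

lemma ex_skew_bounds: "\<exists>q. \<forall>n. \<forall>i\<le>n. skew_bound \<sigma> \<delta> n (fps_nth t i) (q n)"
proof -
  have 1: "\<exists>N. skew_bound \<sigma> \<delta> n a N" for n a
  proof -
    obtain N where N: "\<And>i j. i \<ge> N \<Longrightarrow> j \<le> int n \<Longrightarrow> fls_nth (P i (poly_to_fls [:a:])) j = 0"
      using P_high by blast
    show ?thesis
      by (rule exI[of _ "nat N"]) (auto simp: skew_bound_def coeff_skew_monom_mult intro!: N)
  qed
  then obtain B where B: "\<And>n a. skew_bound \<sigma> \<delta> n a (B n a)" by metis
  have "skew_bound \<sigma> \<delta> n (fps_nth t i) (Max ((\<lambda>i. B n (fps_nth t i)) ` {..n}))" if "i \<le> n" for n i
  proof -
    have "B n (fps_nth t i) \<le> Max ((\<lambda>i. B n (fps_nth t i)) ` {..n})" using that by simp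
    then show ?thesis using B[of n "fps_nth t i"] unfolding skew_bound_def by (meson order_trans)
  qed
  then show ?thesis
    by (intro exI[of _ "\<lambda>n. Max ((\<lambda>i. B n (fps_nth t i)) ` {..n})"]) blast
qed

lemma skew_laurent_mult_unique:
  assumes "is_skew_laurent_mult \<sigma> \<delta> mul"
  shows "mul = lm"
proof -
  interpret M: ring_1 "1 :: 'a fls" mul "(+)" 0 "(-)" uminus
    using assms by (simp add: is_skew_laurent_mult_def)
  interpret L: ring_1 "1 :: 'a fls" lm "(+)" 0 "(-)" uminus by (rule lm_ring)
  define Z :: "int \<Rightarrow> 'a fls" where "Z = (\<lambda>l. fls_X_intpow l)"
  have Z_0: "Z 0 = 1" by (simp add: Z_def)
  have fps: "\<exists>s' k. s = fls_shift (int k) (fps_to_fls s')" for s :: "'a fls"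
  proof -
    have "- fls_subdegree s \<le> int (nat (- fls_subdegree s))" by simp
    then show ?thesis using fls_as_fps' by blast
  qed
  have Z_fps: "\<exists>s. Z (int k) = fps_to_fls s" for k
    unfolding Z_def by (intro exI[of _ "fps_X ^ k"] fls_eqI) (auto simp: nat_eq_iff)
  have lZ: "lm u (Z l) = fls_shift (- l) u" for u l
    unfolding Z_def by (rule lm_X_right)
  have ZZ: "fls_shift (- l) (Z k) = Z (k + l)" for k l
    by (rule fls_eqI) (auto simp: Z_def)
  have sZ: "mul (fps_to_fls s) (Z l) = fls_shift (- l) (fps_to_fls s)" for s l
    using assms by (simp add: is_skew_laurent_mult_def Z_def)
  have st: "mul (fps_to_fls s) (fps_to_fls t) = lm (fps_to_fls s) (fps_to_fls t)" for s t
  proof -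
    obtain q where q: "\<forall>n. \<forall>i\<le>n. skew_bound \<sigma> \<delta> n (fps_nth t i) (q n)" using ex_skew_bounds by blast
    show ?thesis using assms lm_power[OF q] q by (simp add: is_skew_laurent_mult_def)
  qed
  have Zs: "mul (Z (- 1)) (fps_to_fls s) = lm (Z (- 1)) (fps_to_fls s)" for s
  proof -
    obtain m where m: "1 \<le> m" "\<delta> ^^ m = (\<lambda>_. 0)" "\<delta>' ^^ m = (\<lambda>_. 0)" using ex_m by blast
    have "mul' (Z (- 1)) (fps_to_fls s) =
        (\<Sum>k\<le>m. fls_shift (1 + int k) (fls_map (\<sigma>' \<circ> \<delta>' ^^ k) (fps_to_fls s)))"
      if "is_skew_laurent_mult \<sigma> \<delta> mul'" for mul'
      using that m unfolding is_skew_laurent_mult_def Z_def by blast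
    from this[OF assms] this[OF lm_is] show ?thesis by simp
  qed
  have ZZ_pos: "mul (Z (int k)) (Z l) = Z (int k + l)" for k l
    using Z_fps[of k] sZ ZZ by metis
  have Z_inv: "mul (Z (- 1)) (Z 1) = 1"
  proof -
    have "mul (Z (- 1)) (Z 1) = lm (Z (- 1)) (Z 1)" using Z_fps[of 1] Zs by auto
    also have "\<dots> = 1" unfolding lZ ZZ by (simp add: Z_0)
    finally show ?thesis .
  qed
  have left_inv: "mul (Z (- 1)) (mul (Z 1) w) = w" for w
    by (simp only: M.mult_assoc[symmetric] Z_inv M.mult_1_left)
  have cancel: "u = v" if "mul (Z (int k)) u = mul (Z (int k)) v" for k u v
    using that
  proof (induction k)
    case 0 then show ?case by (simp add: Z_0)
  next
    case (Suc k)
    have "Z (int (Suc k)) = mul (Z 1) (Z (int k))" using ZZ_pos[of 1 "int k"] by simp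
    then have "mul (Z 1) (mul (Z (int k)) u) = mul (Z 1) (mul (Z (int k)) v)"
      using Suc.prems by (simp only: M.mult_assoc)
    then show ?case using Suc.IH left_inv by metis
  qed
  have ZZ_all: "mul (Z a) (Z b) = Z (a + b)" for a b
  proof (cases "a < 0")
    case True
    define k where "k = nat (- a)"
    have k: "int k + a = 0" using True by (simp add: k_def)
    have "mul (Z (int k)) (mul (Z a) (Z b)) = Z b"
      unfolding M.mult_assoc[symmetric] ZZ_pos k Z_0 by (rule M.mult_1_left)
    moreover have "mul (Z (int k)) (Z (a + b)) = Z b"
      unfolding ZZ_pos using k by (simp add: add.assoc[symmetric])
    ultimately show ?thesis using cancel by metis
  next
    case False
    then show ?thesis using ZZ_pos[of "nat a" b] by simp
  qed
  have uZ: "mul u (Z l) = lm u (Z l)" for u l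
  proof -
    obtain s k where u: "u = fls_shift (int k) (fps_to_fls s)" using fps by blast
    then have u': "u = mul (fps_to_fls s) (Z (- int k))" unfolding sZ by simp
    have "mul u (Z l) = fls_shift (- (- int k + l)) (fps_to_fls s)"
      unfolding u' M.mult_assoc ZZ_all by (rule sZ)
    also have "\<dots> = lm u (Z l)" unfolding lZ u by simp
    finally show ?thesis .
  qed
  have decomp: "\<exists>s l. u = lm (fps_to_fls s) (Z l) \<and> u = mul (fps_to_fls s) (Z l)" for u
    using fps[of u] by (metis uZ lZ minus_minus)
  have Z1: "mul (Z (- 1)) u = lm (Z (- 1)) u" for u
  proof -
    obtain s l where s: "u = lm (fps_to_fls s) (Z l)" "u = mul (fps_to_fls s) (Z l)"
      using decomp by blast
    have "mul (Z (- 1)) u = mul (mul (Z (- 1)) (fps_to_fls s)) (Z l)"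
      unfolding M.mult_assoc s(2)[symmetric] ..
    also have "\<dots> = lm (lm (Z (- 1)) (fps_to_fls s)) (Z l)" unfolding Zs uZ ..
    also have "\<dots> = lm (Z (- 1)) u" unfolding lm_assoc s(1)[symmetric] ..
    finally show ?thesis .
  qed
  have Zt: "mul (Z (- int k)) t = lm (Z (- int k)) t" for k t
  proof (induction k)
    case 0 then show ?case by (simp add: Z_0)
  next
    case (Suc k)
    have e: "Z (- int (Suc k)) = mul (Z (- 1)) (Z (- int k))" unfolding ZZ_all by simp
    have "mul (Z (- int (Suc k))) t = lm (Z (- 1)) (lm (Z (- int k)) t)"
      unfolding e M.mult_assoc Suc.IH by (rule Z1)
    also have "\<dots> = lm (Z (- int (Suc k))) t" unfolding e Z1 lm_assoc ..
    finally show ?case .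
  qed
  show ?thesis
  proof (intro ext)
    fix s t :: "'a fls"
    obtain s' k where "s = fls_shift (int k) (fps_to_fls s')" using fps by blast
    then have s: "s = lm (fps_to_fls s') (Z (- int k))" unfolding lZ by simp
    then have s2: "s = mul (fps_to_fls s') (Z (- int k))" unfolding uZ .
    obtain t' l where t: "lm (Z (- int k)) t = lm (fps_to_fls t') (Z l)"
        "lm (Z (- int k)) t = mul (fps_to_fls t') (Z l)" using decomp by blast
    have "mul s t = mul (fps_to_fls s') (lm (Z (- int k)) t)"
      by (subst s2) (simp only: M.mult_assoc Zt)
    also have "\<dots> = mul (mul (fps_to_fls s') (fps_to_fls t')) (Z l)"
      unfolding t(2) M.mult_assoc ..
    also have "\<dots> = lm (fps_to_fls s') (lm (Z (- int k)) t)" unfolding uZ st t(1) lm_assoc ..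
    also have "\<dots> = lm s t" unfolding lm_assoc[symmetric] s[symmetric] ..
    finally show "mul s t = lm s t" .
  qed
qed

end

theorem ex1_skew_laurent_mult:
  assumes "left_skew_derivation \<sigma> \<delta>" "bij \<sigma>"
    "nilpotent_map \<delta>" "nilpotent_map (dual_derivation \<sigma> \<delta>)"
  shows "\<exists>!mul. is_skew_laurent_mult \<sigma> \<delta> mul"
proof -
  interpret nilpotent_skew_derivation \<sigma> \<delta> using assms by unfold_locales
  show ?thesis using lm_is skew_laurent_mult_unique by blast
qed

corollary is_skew_laurent_mult_skew_laurent_mult:
  assumes "left_skew_derivation \<sigma> \<delta>" "bij \<sigma>"
    "nilpotent_map \<delta>" "nilpotent_map (dual_derivation \<sigma> \<delta>)"
  shows "is_skew_laurent_mult \<sigma> \<delta> (skew_laurent_mult \<sigma> \<delta>)"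
  unfolding skew_laurent_mult_def by (rule theI'[OF ex1_skew_laurent_mult[OF assms]])

end

(*
  Since \<sigma> and \<delta> are F-linear, X commutes with F, so A((X)) and A[X] are the coordinatewise
  F((X))- and F[X]-modules on a basis of A. If D is a vector space over F((X)), the quotient
  of A[X] by its intersection with D is finitely generated and torsion-free over F[X], hence free,
  and the intersection has a complement. Conversely, the F((X))-span of an ideal I with complement
  meets A[X] in I, because the projection along I extends to an F((X))-linear map. The span is
  closed under right multiplication because every element of A((X)) is a finite sum of a g with
  a in A and g in F((X)).
*)

theory Submission
  imports Defs
begin

section \<open>Complements of submodules with torsion-free quotient over a Euclidean ring\<close>

text \<open>Replacing \<open>e\<^sub>i\<close> by \<open>e\<^sub>i + q e\<^sub>j\<close> runs the Euclidean algorithm on the coefficients of a relation;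
  once \<open>c\<^sub>i\<close> divides all of them, torsion-freeness makes \<open>e\<^sub>i\<close> redundant.\<close>

lemma torsion_free_relation_reduces:
  fixes scale :: "'r::euclidean_ring \<Rightarrow> 'm::ab_group_add \<Rightarrow> 'm" (infixr "\<odot>" 75)
  assumes "module scale" and N: "module.subspace scale N"
    and torsion_free: "\<And>r x. r \<noteq> 0 \<Longrightarrow> r \<odot> x \<in> N \<Longrightarrow> x \<in> N"
    and S: "finite S"
  shows "i \<in> S \<Longrightarrow> c i \<noteq> 0 \<Longrightarrow> (\<Sum>j\<in>S. c j \<odot> e j) \<in> N \<Longrightarrow>
    (\<And>x. \<exists>f. x - (\<Sum>j\<in>S. f j \<odot> e j) \<in> N) \<Longrightarrow>
    \<exists>k\<in>S. \<exists>e'. \<forall>x. \<exists>f. x - (\<Sum>j\<in>S - {k}. f j \<odot> e' j) \<in> N"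
proof (induction "euclidean_size (c i)" arbitrary: i c e rule: less_induct)
  case less
  interpret module scale by fact
  show ?case
  proof (cases "\<forall>j\<in>S. c i dvd c j")
    case True
    then have "\<forall>j. \<exists>q. j \<in> S \<longrightarrow> c j = c i * q" by (auto elim: dvdE)
    then obtain q where q: "\<And>j. j \<in> S \<Longrightarrow> c j = c i * q j" by metis
    have qi: "q i = 1" using q[OF less.prems(1)] less.prems(2) by simp
    define w where "w = (\<Sum>j\<in>S. q j \<odot> e j)"
    have "c i \<odot> w = (\<Sum>j\<in>S. c j \<odot> e j)"
      unfolding w_def scale_sum_right by (rule sum.cong) (simp_all add: q)
    then have w: "w \<in> N" using torsion_free less.prems by metis
    have wi: "w = e i + (\<Sum>j\<in>S - {i}. q j \<odot> e j)"
      unfolding w_def using S less.prems(1) by (simp add: sum.remove[of S i] qi)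
    have "\<exists>f. x - (\<Sum>j\<in>S - {i}. f j \<odot> e j) \<in> N" for x
    proof -
      obtain f where f: "x - (\<Sum>j\<in>S. f j \<odot> e j) \<in> N" using less.prems(4) by blast
      have "x - (\<Sum>j\<in>S - {i}. (f j - f i * q j) \<odot> e j) = (x - (\<Sum>j\<in>S. f j \<odot> e j)) + f i \<odot> w"
        unfolding wi using S less.prems(1)
        by (simp add: sum.remove[of S i] algebra_simps sum_subtractf scale_sum_right)
      also have "\<dots> \<in> N" using f w N by (simp add: subspace_add subspace_scale)
      finally show ?thesis by (rule exI[of _ "\<lambda>j. f j - f i * q j"])
    qed
    then show ?thesis using less.prems(1) by blast
  next
    case False
    then obtain j where j: "j \<in> S" "\<not> c i dvd c j" by blast
    then have ij: "j \<noteq> i" by auto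
    define q where "q = c j div c i"
    define e' where "e' = e(i := e i + q \<odot> e j)"
    have S': "(\<Sum>k\<in>S. g k) = g i + (g j + (\<Sum>k\<in>S - {i} - {j}. g k))" for g :: "'a \<Rightarrow> 'm"
      using S j ij less.prems(1) by (simp add: sum.remove[of S i] sum.remove[of "S - {i}" j])
    \<comment> \<open>The change of \<open>f j\<close> cancels the multiple of \<open>e j\<close>
      added to \<open>e i\<close>. Both families have the same combinations, so relation and
      generation carry over.\<close>
    have e': "(\<Sum>k\<in>S. (f(j := f j - f i * q)) k \<odot> e' k) = (\<Sum>k\<in>S. f k \<odot> e k)" for f
      unfolding S' using ij by (simp add: e'_def algebra_simps)
    \<comment> \<open>The new pivot is \<open>j\<close>: its coefficient becomes
      \<open>c j mod c i\<close>, nonzero by the choice of \<open>j\<close> and of smaller Euclidean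
      size than \<open>c i\<close>.\<close>
    show ?thesis
    proof (rule less.hyps[of "c(j := c j - c i * q)" j e'])
      have *: "c j - c i * q = c j mod c i" by (simp add: q_def minus_mult_div_eq_mod)
      show "euclidean_size ((c(j := c j - c i * q)) j) < euclidean_size (c i)"
        using less.prems(2) by (simp add: * mod_size_less)
      show "(c(j := c j - c i * q)) j \<noteq> 0" using j by (simp add: * mod_eq_0_iff_dvd)
      show "(\<Sum>k\<in>S. (c(j := c j - c i * q)) k \<odot> e' k) \<in> N" unfolding e' by (rule less.prems)
      show "\<exists>f. x - (\<Sum>k\<in>S. f k \<odot> e' k) \<in> N" for x
      proof -
        obtain f where "x - (\<Sum>k\<in>S. f k \<odot> e k) \<in> N" using less.prems(4) by blast
        then show ?thesis by (intro exI[of _ "f(j := f j - f i * q)"]) (simp only: e')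
      qed
    qed (rule j)
  qed
qed

text \<open>Each nontrivial relation modulo \<open>N\<close> lowers the number of generators of the
  quotient. The reduction also changes the family, so \<open>e\<close> varies in the
  induction.\<close>

lemma torsion_free_quotient_complement:
  fixes scale :: "'r::euclidean_ring \<Rightarrow> 'm::ab_group_add \<Rightarrow> 'm" (infixr "\<odot>" 75)
  assumes "module scale" and N: "module.subspace scale N"
    and torsion_free: "\<And>r x. r \<noteq> 0 \<Longrightarrow> r \<odot> x \<in> N \<Longrightarrow> x \<in> N"
    and S: "finite S" and gen: "\<And>x. \<exists>f. x - (\<Sum>j\<in>S. f j \<odot> e j) \<in> N"
  shows "\<exists>J. module.subspace scale J \<and> N \<inter> J = {0} \<and> (\<forall>x. \<exists>u\<in>N. \<exists>v\<in>J. x = u + v)"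
  using S gen
proof (induction "card S" arbitrary: S e rule: less_induct)
  case less
  interpret module scale by fact
  show ?case
  proof (cases "\<exists>i\<in>S. \<exists>c. c i \<noteq> 0 \<and> (\<Sum>j\<in>S. c j \<odot> e j) \<in> N")
    case True
    then obtain i c where ic: "i \<in> S" "c i \<noteq> 0" "(\<Sum>j\<in>S. c j \<odot> e j) \<in> N" by blast
    have "\<exists>k\<in>S. \<exists>e'. \<forall>x. \<exists>f. x - (\<Sum>j\<in>S - {k}. f j \<odot> e' j) \<in> N"
      by (rule torsion_free_relation_reduces[OF assms(1) N torsion_free less.prems(1) ic less.prems(2)])
    then obtain k e' where "k \<in> S" "\<And>x. \<exists>f. x - (\<Sum>j\<in>S - {k}. f j \<odot> e' j) \<in> N" by blast
    then show ?thesis using less.prems(1) by (intro less.hyps[of "S - {k}" e'] card_Diff1_less) auto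
  next
    case False
    \<comment> \<open>With no relation left, the \<open>e j\<close> are independent modulo
      \<open>N\<close>, so their combinations meet \<open>N\<close> only in 0.\<close>
    define J where "J = range (\<lambda>f. \<Sum>j\<in>S. f j \<odot> e j)"
    have "subspace J"
    proof (rule subspaceI)
      show "0 \<in> J" unfolding J_def by (rule range_eqI[of _ _ "\<lambda>_. 0"]) simp
      show "x + y \<in> J" if "x \<in> J" "y \<in> J" for x y
      proof -
        obtain f g where "x = (\<Sum>j\<in>S. f j \<odot> e j)" "y = (\<Sum>j\<in>S. g j \<odot> e j)"
          using \<open>x \<in> J\<close> \<open>y \<in> J\<close> unfolding J_def by blast
        then have "x + y = (\<Sum>j\<in>S. (f j + g j) \<odot> e j)"
          by (simp add: scale_left_distrib sum.distrib)
        then show ?thesis by (simp add: J_def)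
      qed
      show "r \<odot> x \<in> J" if "x \<in> J" for r x
      proof -
        obtain f where "x = (\<Sum>j\<in>S. f j \<odot> e j)" using \<open>x \<in> J\<close> unfolding J_def by blast
        then have "r \<odot> x = (\<Sum>j\<in>S. (r * f j) \<odot> e j)" by (simp add: scale_sum_right)
        then show ?thesis by (simp add: J_def)
      qed
    qed
    moreover have "x = 0" if "x \<in> N" "x \<in> J" for x
    proof -
      obtain f where f: "x = (\<Sum>j\<in>S. f j \<odot> e j)" using \<open>x \<in> J\<close> unfolding J_def by blast
      then have "\<forall>j\<in>S. f j = 0" using False \<open>x \<in> N\<close> by auto
      then show ?thesis using f by simp
    qed
    then have "N \<inter> J = {0}" using subspace_0[OF N] subspace_0[OF \<open>subspace J\<close>] by blast
    moreover have "\<exists>u\<in>N. \<exists>v\<in>J. x = u + v" for x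
    proof -
      obtain f where "x - (\<Sum>j\<in>S. f j \<odot> e j) \<in> N" using less.prems(2) by blast
      then show ?thesis
        by (intro bexI[of _ "x - (\<Sum>j\<in>S. f j \<odot> e j)"] bexI[of _ "\<Sum>j\<in>S. f j \<odot> e j"])
          (auto simp: J_def)
    qed
    ultimately show ?thesis by blast
  qed
qed

section \<open>Laurent series products and the embedding of polynomials\<close>

lemma fls_times_nth_lower_bounds:
  assumes "\<And>i. i < e \<Longrightarrow> fls_nth f i = 0" "\<And>i. i < d \<Longrightarrow> fls_nth g i = 0"
  shows "fls_nth (f * g :: 'a::comm_ring_1 fls) n = (\<Sum>i=d..n - e. fls_nth f (n - i) * fls_nth g i)"
\<comment> \<open>The zero series has subdegree 0 by convention, so \<open>e\<close> and
  \<open>d\<close> bound the subdegrees only for nonzero factors.\<close>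
proof (cases "f = 0 \<or> g = 0")
  case True
  then show ?thesis by auto
next
  case False
  then have "e \<le> fls_subdegree f" "d \<le> fls_subdegree g"
    using assms nth_fls_subdegree_nonzero not_le by metis+
  then have "(\<Sum>i=d..n - e. fls_nth g i * fls_nth f (n - i)) = fls_nth (g * f) n"
    unfolding fls_times_nth(2) by (intro sum.mono_neutral_right) auto
  then show ?thesis by (simp add: mult.commute)
qed

lemma inj_poly_to_fls: "inj poly_to_fls"
  by (simp add: inj_def poly_to_fls_def fps_of_poly_eq_iff)

text \<open>The products in \<open>poly_to_fls_mult\<close> are the commutative ones with X central;
  they serve the scalars in F[X] and F((X)).\<close>

lemma poly_to_fls_add: "poly_to_fls (p + q) = poly_to_fls p + poly_to_fls q"
  and poly_to_fls_0 [simp]: "poly_to_fls 0 = 0"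
  and poly_to_fls_1 [simp]: "poly_to_fls 1 = 1"
  and poly_to_fls_mult: "poly_to_fls (f * g) = poly_to_fls f * poly_to_fls g"
  and poly_to_fls_const: "poly_to_fls [:a:] = fls_const a"
  by (simp_all add: poly_to_fls_def fps_of_poly_add fps_of_poly_mult fps_of_poly_const
      fls_times_fps_to_fls)

lemma poly_to_fls_sum: "poly_to_fls (sum f A) = (\<Sum>x\<in>A. poly_to_fls (f x))"
  by (induction A rule: infinite_finite_induct) (auto simp: poly_to_fls_add)

lemma poly_to_fls_map_poly: "L 0 = 0 \<Longrightarrow> poly_to_fls (map_poly L p) = fls_map L (poly_to_fls p)"
  by (rule fls_eqI) (simp add: nth_poly_to_fls nth_fls_map coeff_map_poly)

section \<open>Scalar actions in coordinates\<close>

locale finite_dimensional_skew_algebra =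
  finite_dimensional_vector_space smul Basis + unital_algebra smul + nilpotent_skew_derivation \<sigma> \<delta>
  for smul :: "'f::field \<Rightarrow> 'a::ring_1 \<Rightarrow> 'a" and Basis and \<sigma> \<delta> :: "'a \<Rightarrow> 'a" +
  assumes \<sigma>_smul: "\<sigma> (smul c a) = smul c (\<sigma> a)" and \<delta>_smul: "\<delta> (smul c a) = smul c (\<delta> a)"
begin

abbreviation lscale (infixr "*L" 75) where "lscale \<equiv> laurent_scale smul \<sigma> \<delta>"
abbreviation pscale (infixr "*P" 75) where "pscale \<equiv> poly_scale smul \<sigma> \<delta>"
abbreviation embed :: "'f fls \<Rightarrow> 'a fls" where "embed \<equiv> fls_map (\<lambda>c. smul c 1)"

lemma skew_laurent_mult_eq: "skew_laurent_mult \<sigma> \<delta> = lm"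
  by (intro skew_laurent_mult_unique is_skew_laurent_mult_skew_laurent_mult der bij nil nil')

lemma laurent_scale_eq: "f *L s = lm s (embed f)"
  by (simp add: laurent_scale_def skew_laurent_mult_eq)

lemma nth_embed: "fls_nth (embed f) n = smul (fls_nth f n) 1"
  by (simp add: nth_fls_map)

text \<open>\<open>P i\<close> is left multiplication by the i-th power of X. By linearity \<sigma>
  fixes the multiples of 1 and \<delta> kills them, so \<open>T\<close> merely shifts.\<close>

lemma P_embed: "P i (embed f) = fls_shift (- i) (embed f)"
proof -
  have T: "T (fls_shift k (embed f)) = fls_shift (k - 1) (embed f)" for k
    by (rule fls_eqI) (simp add: T_nth nth_embed \<sigma>_smul \<delta>_smul algebra_simps)
  show ?thesis
  proof (induction i rule: int_updown)
    case 0 then show ?case by simp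
  next
    case (up i) then show ?case using T[of "- i"] by (simp flip: T_P)
  next
    case (down i)
    then show ?case using T[of "- (i - 1)"] inv_T_T[of "fls_shift (- (i - 1)) (embed f)"]
      by (simp add: P_minus)
  qed
qed

lemma mult_embed_nth: "a * fls_nth (P i (embed f)) n = smul (fls_nth f (n - i)) a"
  by (simp add: P_embed nth_embed scale_mult_right)

lemma laurent_scale_nth:
  assumes "\<And>i. i < e \<Longrightarrow> fls_nth f i = 0" "\<And>i. i < d \<Longrightarrow> fls_nth s i = 0"
  shows "fls_nth (f *L s) n = (\<Sum>i=d..n - e. smul (fls_nth f (n - i)) (fls_nth s i))"
  unfolding laurent_scale_eq mult_embed_nth[symmetric]
  by (rule lm_sum) (auto simp: P_embed nth_embed assms not_le)

lemma laurent_scale_const_nth: "fls_nth (f *L fls_const a) n = smul (fls_nth f n) a"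
proof -
  have "fls_nth (f *L fls_const a) n = (\<Sum>i\<in>{0}. fls_nth (fls_const a) i * fls_nth (P i (embed f)) n)"
    unfolding laurent_scale_eq by (rule lm_sum) auto
  then show ?thesis using mult_embed_nth[of a 0 f n] by simp
qed

definition coord :: "'a \<Rightarrow> 'a \<Rightarrow> 'f" where "coord b a = representation Basis a b"

lemma coord_add: "coord b (x + y) = coord b x + coord b y"
  and coord_smul: "coord b (smul c x) = c * coord b x"
  and coord_0 [simp]: "coord b 0 = 0"
  and sum_coord: "(\<Sum>b\<in>Basis. smul (coord b x) b) = x"
  unfolding coord_def using representation_add[OF independent_Basis] representation_scale[OF independent_Basis]
  by (simp_all add: span_Basis representation_zero sum_representation_eq finite_Basis independent_Basis)

lemma coord_sum: "coord b (sum f S) = (\<Sum>x\<in>S. coord b (f x))"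
  by (induction S rule: infinite_finite_induct) (auto simp: coord_add)

abbreviation lcoord :: "'a \<Rightarrow> 'a fls \<Rightarrow> 'f fls" where "lcoord b \<equiv> fls_map (coord b)"

lemma lcoord_add: "lcoord b (s + t) = lcoord b s + lcoord b t"
  by (rule fls_eqI) (simp add: nth_fls_map coord_add)

lemma lcoord_0 [simp]: "lcoord b 0 = 0"
  by (rule fls_eqI) (simp add: nth_fls_map)

text \<open>Over common lower bounds both sides are the same finite convolution. In coordinates the
  skew right action is thus ordinary multiplication in F((X)).\<close>

lemma lcoord_scale: "lcoord b (f *L s) = f * lcoord b s"
proof (rule fls_eqI)
  fix n
  obtain e where e: "\<And>i. i < e \<Longrightarrow> fls_nth f i = 0" using fls_eq0_below_subdegree by blast
  obtain d where d: "\<And>i. i < d \<Longrightarrow> fls_nth s i = 0" using low by blast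
  have "fls_nth (f * lcoord b s) n = (\<Sum>i=d..n - e. fls_nth f (n - i) * fls_nth (lcoord b s) i)"
    by (rule fls_times_nth_lower_bounds) (simp_all add: e d nth_fls_map)
  moreover have "fls_nth (f *L s) n = (\<Sum>i=d..n - e. smul (fls_nth f (n - i)) (fls_nth s i))"
    by (rule laurent_scale_nth) (simp_all add: e d)
  ultimately show "fls_nth (lcoord b (f *L s)) n = fls_nth (f * lcoord b s) n"
    by (simp add: nth_fls_map coord_sum coord_smul)
qed

lemma laurent_expansion: "s = (\<Sum>b\<in>Basis. lcoord b s *L fls_const b)"
  by (rule fls_eqI) (simp add: fls_nth_sum laurent_scale_const_nth nth_fls_map sum_coord)

lemma lcoord_eqI: "(\<And>b. lcoord b s = lcoord b t) \<Longrightarrow> s = t"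
  by (metis (no_types, lifting) laurent_expansion sum.cong)

text \<open>In each coordinate the axioms become identities in the field F((X)).\<close>

sublocale L: vector_space lscale
proof unfold_locales
  show "1 *L s = s" for s by (rule lcoord_eqI) (simp add: lcoord_scale)
qed (rule lcoord_eqI, simp add: lcoord_scale lcoord_add algebra_simps)+

lemma poly_to_fls_scale: "poly_to_fls (f *P p) = poly_to_fls f *L poly_to_fls p"
  by (simp add: poly_scale_def laurent_scale_eq poly_to_fls_map_poly flip: lm_poly)

text \<open>The axioms are pulled back from A((X)) along the injection
  \<open>poly_to_fls\<close>.\<close>

sublocale R: module pscale
  by unfold_locales (rule injD[OF inj_poly_to_fls],
    simp add: poly_to_fls_scale poly_to_fls_add poly_to_fls_mult L.scale_left_distrib L.scale_right_distrib)+

lemma poly_expansion: "p = (\<Sum>b\<in>Basis. map_poly (coord b) p *P [:b:])"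
  by (rule injD[OF inj_poly_to_fls])
    (subst laurent_expansion, simp add: poly_to_fls_sum poly_to_fls_scale poly_to_fls_map_poly poly_to_fls_const)

lemma lm_sum_right: "lm s (sum f S) = (\<Sum>x\<in>S. lm s (f x))"
proof -
  interpret ring_1 "1 :: 'a fls" lm "(+)" 0 "(-)" uminus by (rule lm_ring)
  show ?thesis
    by (induction S rule: infinite_finite_induct) (simp_all add: lm_add_right)
qed

lemma lm_scale_right: "lm s (f *L t) = f *L lm s t"
  by (simp add: laurent_scale_eq lm_assoc)

lemma lm_expansion: "lm s t = (\<Sum>b\<in>Basis. lcoord b t *L lm s (fls_const b))"
  by (subst laurent_expansion[of t]) (simp add: lm_sum_right lm_scale_right)

text \<open>The hypothesis concerns one fixed \<open>s\<close>, so it can be applied to a generator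
  of a span before the span is known to be stable.\<close>

lemma lm_mem_subspace:
  assumes "L.subspace D" "\<And>a. lm s (fls_const a) \<in> D"
  shows "lm s t \<in> D"
  unfolding lm_expansion[of s t] using assms by (intro L.subspace_sum L.subspace_scale)

section \<open>Contraction of codes and extension of ideals\<close>

lemma convolutional_code_eq_span:
  assumes "convolutional_code smul \<sigma> \<delta> D"
  shows "L.span (D \<inter> range poly_to_fls) = D"
proof -
  obtain B where B: "B \<subseteq> range poly_to_fls" "L.span B = D" and D: "L.subspace D"
    using assms by (auto simp: convolutional_code_def)
  then have "B \<subseteq> D \<inter> range poly_to_fls" using L.span_superset by blast
  then have "D \<subseteq> L.span (D \<inter> range poly_to_fls)" using B(2) L.span_mono by blast
  then show ?thesis using L.span_minimal[OF _ D] by blast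
qed

text \<open>Over a field every spanning set contains a basis, so spanning by polynomials already
  gives a polynomial basis.\<close>

lemma convolutional_code_span_poly:
  "convolutional_code smul \<sigma> \<delta> (L.span (poly_to_fls ` I))"
proof -
  obtain B where B: "B \<subseteq> poly_to_fls ` I" "L.independent B" "poly_to_fls ` I \<subseteq> L.span B"
    by (rule L.maximal_independent_subset)
  then have "L.span B = L.span (poly_to_fls ` I)"
    by (metis L.span_mono L.span_span subset_antisym)
  then show ?thesis
    using B unfolding convolutional_code_def by (intro conjI exI[of _ B] L.subspace_span) auto
qed

lemma right_ideal_code_contraction:
  assumes "cyclic_convolutional_code smul \<sigma> \<delta> D"
  shows "right_ideal_code smul \<sigma> \<delta> {p. poly_to_fls p \<in> D}"
proof -
  let ?I = "{p. poly_to_fls p \<in> D}"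
  have D: "L.subspace D" and cyclic: "\<And>s a. s \<in> D \<Longrightarrow> lm s (fls_const a) \<in> D"
    using assms by (auto simp: cyclic_convolutional_code_def convolutional_code_def skew_laurent_mult_eq)
  have I: "R.subspace ?I"
    using L.subspace_0[OF D] L.subspace_add[OF D] L.subspace_scale[OF D]
    by (intro R.subspaceI) (auto simp: poly_to_fls_add poly_to_fls_scale)
  have "skew_right_ideal \<sigma> \<delta> ?I"
    using lm_mem_subspace[OF D] cyclic R.subspace_0[OF I] R.subspace_add[OF I]
    by (auto simp: skew_right_ideal_def simp flip: lm_poly)
  moreover have "\<exists>J. R.subspace J \<and> ?I \<inter> J = {0} \<and> (\<forall>p. \<exists>u\<in>?I. \<exists>v\<in>J. p = u + v)"
  proof (rule torsion_free_quotient_complement[OF R.module_axioms I])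
    \<comment> \<open>Nonzero polynomials are invertible in F((X)), and \<open>D\<close> is closed
      under their inverses.\<close>
    show "p \<in> ?I" if "r \<noteq> 0" "r *P p \<in> ?I" for r p
    proof -
      have "poly_to_fls r \<noteq> 0" using \<open>r \<noteq> 0\<close> injD[OF inj_poly_to_fls, of r 0] by auto
      then have "poly_to_fls p = inverse (poly_to_fls r) *L poly_to_fls (r *P p)"
        by (simp add: poly_to_fls_scale)
      then show ?thesis using that(2) L.subspace_scale[OF D] by simp
    qed
    \<comment> \<open>The constants from \<open>Basis\<close> generate all of A[X], so the
      difference can be made 0.\<close>
    show "\<exists>f. p - (\<Sum>b\<in>Basis. f b *P [:b:]) \<in> ?I" for p
      using L.subspace_0[OF D]
      by (intro exI[of _ "\<lambda>b. map_poly (coord b) p"]) (simp flip: poly_expansion)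
  qed (rule finite_Basis)
  ultimately show ?thesis using I unfolding right_ideal_code_def by (intro conjI)
qed

lemma cyclic_span_right_ideal:
  assumes "skew_right_ideal \<sigma> \<delta> I"
  shows "cyclic_convolutional_code smul \<sigma> \<delta> (L.span (poly_to_fls ` I))"
proof -
  let ?D = "L.span (poly_to_fls ` I)"
  have "lm s t \<in> ?D" if "s \<in> ?D" for s t
    using that
  proof (induction s arbitrary: t rule: L.span_induct_alt)
    case base
    have "lm 0 t = 0" using lm_add_left[of 0 0 t] by simp
    then show ?case by (simp add: L.span_zero)
  next
    case (step f s s')
    then obtain p where p: "p \<in> I" "s = poly_to_fls p" by blast
    have "lm s (fls_const b) \<in> ?D" for b
      using p assms unfolding p(2) poly_to_fls_const[symmetric] lm_poly
      by (intro L.span_base) (auto simp: skew_right_ideal_def)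
    \<comment> \<open>Moving the scalar across gives (s f) t = s (f t). Its right factor is a series
      even for constant \<open>t\<close>, so closure under constants must first be extended to all
      series.\<close>
    then have "lm s (lm (embed f) t) \<in> ?D" by (rule lm_mem_subspace[OF L.subspace_span])
    moreover have "lm (f *L s + s') t = lm s (lm (embed f) t) + lm s' t"
      by (simp add: lm_add_left laurent_scale_eq lm_assoc)
    ultimately show ?case using step.IH L.span_add by metis
  qed
  then show ?thesis
    unfolding cyclic_convolutional_code_def skew_laurent_mult_eq
    using convolutional_code_span_poly by (auto intro: L.span_zero L.span_add)
qed

text \<open>The projection of \<open>A[X]\<close> onto \<open>J\<close> along \<open>I\<close> is determined by the components \<open>v b\<close> of the
  basis elements, and the same formula extends it to an \<open>F((X))\<close>-linear map on \<open>A((X))\<close>.\<close>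

lemma contraction_span_direct_summand:
  assumes I: "R.subspace I" and J: "R.subspace J" and IJ: "I \<inter> J = {0}"
    and sum: "\<And>p. \<exists>u\<in>I. \<exists>v\<in>J. p = u + v"
    and p: "poly_to_fls p \<in> L.span (poly_to_fls ` I)"
  shows "p \<in> I"
proof -
  have "\<exists>u. u \<in> I \<and> [:b:] - u \<in> J" for b
  proof -
    obtain u v where "u \<in> I" "v \<in> J" "[:b:] = u + v" using sum by blast
    then show ?thesis by (intro exI[of _ u]) simp
  qed
  then obtain u where u: "\<And>b. u b \<in> I" "\<And>b. [:b:] - u b \<in> J" by metis
  define v where "v b = [:b:] - u b" for b
  have uv: "\<And>b. u b \<in> I" "\<And>b. v b \<in> J" "\<And>b. [:b:] = u b + v b"
    using u by (simp_all add: v_def)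
  define \<pi> where "\<pi> p = (\<Sum>b\<in>Basis. map_poly (coord b) p *P v b)" for p
  define \<Psi> where "\<Psi> s = (\<Sum>b\<in>Basis. lcoord b s *L poly_to_fls (v b))" for s
  have \<Psi>_poly: "\<Psi> (poly_to_fls p) = poly_to_fls (\<pi> p)" for p
    by (simp add: \<pi>_def \<Psi>_def poly_to_fls_sum poly_to_fls_scale poly_to_fls_map_poly)
  have "p - \<pi> p = (\<Sum>b\<in>Basis. map_poly (coord b) p *P u b)" for p
    by (subst poly_expansion) (simp add: \<pi>_def uv(3) R.scale_right_distrib sum.distrib)
  then have diff: "p - \<pi> p \<in> I" for p
    using uv(1) I by (simp add: R.subspace_sum R.subspace_scale)
  have "\<pi> p \<in> J" for p
    using uv(2) J by (simp add: \<pi>_def R.subspace_sum R.subspace_scale)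
  \<comment> \<open>Here \<open>\<pi> p\<close> is the difference of \<open>p\<close> and
    \<open>p - \<pi> p\<close>, both in \<open>I\<close>; as it also lies in \<open>J\<close>, it
    vanishes.\<close>
  moreover have "\<pi> p \<in> I" if "p \<in> I" for p
    using R.subspace_diff[OF I that diff[of p]] by simp
  ultimately have \<pi>_I: "\<pi> p = 0" if "p \<in> I" for p
    using IJ that by blast
  \<comment> \<open>\<open>\<Psi>\<close> is F((X))-linear and agrees with \<open>\<pi>\<close> on
    polynomials, so it kills the generators.\<close>
  have "\<Psi> s = 0" if "s \<in> L.span (poly_to_fls ` I)" for s
    using that
  proof (induction s rule: L.span_induct_alt)
    case base
    show ?case by (simp add: \<Psi>_def)
  next
    case (step f s s')
    then have "\<Psi> s = 0" using \<Psi>_poly \<pi>_I by auto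
    moreover have "\<Psi> (f *L s + s') = f *L \<Psi> s + \<Psi> s'"
      by (simp add: \<Psi>_def lcoord_add lcoord_scale L.scale_left_distrib sum.distrib L.scale_sum_right)
    ultimately show ?case using step.IH by simp
  qed
  then have "poly_to_fls (\<pi> p) = poly_to_fls 0" using p by (simp flip: \<Psi>_poly)
  then have "\<pi> p = 0" by (rule injD[OF inj_poly_to_fls])
  then show ?thesis using diff[of p] by simp
qed

text \<open>Ideals are represented by their images in A((X)), where the intersection lives; taking
  the F((X))-span is then the inverse map.\<close>

lemma bij_betw_cyclic_right_ideal_codes:
  "bij_betw (\<lambda>D. D \<inter> range poly_to_fls)
    {D. cyclic_convolutional_code smul \<sigma> \<delta> D}
    ((`) poly_to_fls ` {I. right_ideal_code smul \<sigma> \<delta> I})"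
proof (rule bij_betw_byWitness[where f' = L.span])
  have contraction: "D \<inter> range poly_to_fls = poly_to_fls ` {p. poly_to_fls p \<in> D}" for D :: "'a fls set"
    by auto
  show "\<forall>D\<in>{D. cyclic_convolutional_code smul \<sigma> \<delta> D}. L.span (D \<inter> range poly_to_fls) = D"
    by (simp add: cyclic_convolutional_code_def convolutional_code_eq_span)
  show "\<forall>K\<in>(`) poly_to_fls ` {I. right_ideal_code smul \<sigma> \<delta> I}. L.span K \<inter> range poly_to_fls = K"
  proof
    fix K assume "K \<in> (`) poly_to_fls ` {I. right_ideal_code smul \<sigma> \<delta> I}"
    then obtain I where K: "K = poly_to_fls ` I" and I: "right_ideal_code smul \<sigma> \<delta> I" by blast
    then obtain J where "R.subspace I" "R.subspace J" "I \<inter> J = {0}" "\<And>p. \<exists>u\<in>I. \<exists>v\<in>J. p = u + v"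
      unfolding right_ideal_code_def by blast
    then have "p \<in> I" if "poly_to_fls p \<in> L.span (poly_to_fls ` I)" for p
      using that by (rule contraction_span_direct_summand)
    then show "L.span K \<inter> range poly_to_fls = K" unfolding K by (auto intro: L.span_base)
  qed
  show "(\<lambda>D. D \<inter> range poly_to_fls) ` {D. cyclic_convolutional_code smul \<sigma> \<delta> D}
      \<subseteq> (`) poly_to_fls ` {I. right_ideal_code smul \<sigma> \<delta> I}"
    unfolding contraction using right_ideal_code_contraction by blast
  show "L.span ` (`) poly_to_fls ` {I. right_ideal_code smul \<sigma> \<delta> I}
      \<subseteq> {D. cyclic_convolutional_code smul \<sigma> \<delta> D}"
    using cyclic_span_right_ideal by (auto simp: right_ideal_code_def)
qed

end

theorem corollary4p9:
  fixes smul :: "'f::field \<Rightarrow> 'a::ring_1 \<Rightarrow> 'a"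
    and \<sigma> \<delta> :: "'a \<Rightarrow> 'a"
    and \<phi> :: "'a \<Rightarrow> 'f ^ 'n"
  assumes "unital_algebra smul"
    and "\<exists>B. finite_dimensional_vector_space smul B"
    and "vector_space.dim smul (UNIV :: 'a set) = CARD('n)"
    and "Vector_Spaces.linear smul (*s) \<phi>" and "bij \<phi>"
    and "left_skew_derivation \<sigma> \<delta>"
    and "bij \<sigma>" and "Vector_Spaces.linear smul smul \<sigma>"
    and "Vector_Spaces.linear smul smul \<delta>"
    and "nilpotent_map \<delta>" and "nilpotent_map (dual_derivation \<sigma> \<delta>)"
  shows "bij_betw (\<lambda>D. D \<inter> range poly_to_fls)
    {D. cyclic_convolutional_code smul \<sigma> \<delta> D}
    ((`) poly_to_fls ` {I. right_ideal_code smul \<sigma> \<delta> I})"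
proof -
  obtain B where "finite_dimensional_vector_space smul B" using assms(2) by blast
  then interpret finite_dimensional_vector_space smul B .
  interpret unital_algebra smul by fact
  interpret finite_dimensional_skew_algebra smul B \<sigma> \<delta>
    using assms by unfold_locales (simp_all add: Vector_Spaces.linear_iff)
  show ?thesis by (rule bij_betw_cyclic_right_ideal_codes)
qed

end
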